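(* In the setting described in the context, assume that for every $m\ge1$, every $x\in\mathcal X^{\mathbb N}$ and all $y,y'\in\mathcal Y$, $d(F_m(x;y),F_m(x;y'))\le\delta(y,y')$, and that there exist constants $M>0$ and $V_k\ge0$ such that, for every $k\in[1,n]$ and every integer $l\ge2$, $$\mathbb E\big[(G_{\varepsilon_k}(\varepsilon_k))^l\big]\le\frac{l!}{2}\,V_k\,M^{l-2}.$$ Let $V=\sum_{k=1}^n\big(a_{n-k}(n-k)\big)^2V_k$ and $\delta_n=M\,a_{n-1}(n-1)$. Then, for either choice of sign and every $t\in[0,\delta_n^{-1})$, $$\mathbb E\,e^{\pm tS_n}\le\exp\Big(\frac{t^2V}{2(1-t\delta_n)}\Big).$$ Consequently, for every $x>0$, $$\mathbb P(\pm S_n\ge x)\le\exp\Big(\frac{-x^2}{V(1+\sqrt{1+2x\delta_n/V})+x\delta_n}\Big)\le\exp\Big(\frac{-x^2}{2(V+x\delta_n)}\Big).$$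
   Context: Let $(\mathcal X,d)$ and $(\mathcal Y,\delta)$ be complete separable metric spaces. Let $(\varepsilon_i)_{i\ge1}$ be independent (not necessarily identically distributed) $\mathcal Y$-valued random variables, with $P_{\varepsilon_k}$ the law of $\varepsilon_k$. Let $(X_i)_{i\le0}$ be a deterministic sequence in $\mathcal X$. For each $m\ge1$ let $F_m:\mathcal X^{\mathbb N}\times\mathcal Y\to\mathcal X$ be measurable, and define recursively $X_m=F_m((X_{m-i})_{i\ge1};\varepsilon_m)$ for $m\ge1$. Assume there are nonnegative numbers $a_i$, $i\ge1$, with $\sum_{i\ge1}a_i<1$, such that for all $m\ge1$ and all sequences $(x_{m-i})_{i\ge1},(x'_{m-i})_{i\ge1}$ in $\mathcal X$, $$\mathbb E\big[d\big(F_m((x_{m-i})_{i\ge1};\varepsilon_m),F_m((x'_{m-i})_{i\ge1};\varepsilon_m)\big)\big]\le\sum_{i=1}^\infty a_i\,d(x_{m-i},x'_{m-i}).$$ Fix $n\ge1$ and let $f:\mathcal X^n\to\mathbb R$ satisfy $|f(x_1,\ldots,x_n)-f(x'_1,\ldots,x'_n)|\le\sum_{i=1}^n d(x_i,x'_i)$. Put $S_n=f(X_1,\ldots,X_n)-\mathbb E[f(X_1,\ldots,X_n)]$. The numbers $a_k(k)$, $k\ge0$, are defined recursively by $a_0(0)=1$ and $a_k(k)=1+a_k+\sum_{l=1}^{k-1}a_l(l)\,a_{k-l}$ for $k\ge1$ (so $a_1(1)=1+a_1$). $G_{\varepsilon_k}(y)=\int\delta(y,y')\,P_{\varepsilon_k}(dy')$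 for $y\in\mathcal Y$. *)

theory Defs
  imports "HOL-Probability.Probability"
begin

text \<open>An element \<open>x\<close> of \<open>\<X>\<^sup>\<nat>\<close> passed to \<open>F m\<close> is the past \<open>(x\<^sub>m\<^sub>-\<^sub>1, x\<^sub>m\<^sub>-\<^sub>2, \<dots>)\<close>:
  its entry \<open>x j\<close> is the value at time \<open>m - (j + 1)\<close>, hence is weighted by \<open>a (Suc j)\<close>.
  The noise sequence \<open>e\<close> enters at times \<open>\<ge> 1\<close>, the initial sequence \<open>x0\<close> at times \<open>\<le> 0\<close>.\<close>

function chain ::
  "(nat \<Rightarrow> (nat \<Rightarrow> 'x) \<Rightarrow> 'y \<Rightarrow> 'x) \<Rightarrow> (int \<Rightarrow> 'x) \<Rightarrow> (nat \<Rightarrow> 'y) \<Rightarrow> int \<Rightarrow> 'x"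
where
  "chain F x0 e i =
    (if i \<le> 0 then x0 i
     else F (nat i) (\<lambda>j. chain F x0 e (i - int (Suc j))) (e (nat i)))"
  by pat_completeness auto
termination
  by (relation "Wellfounded.measure (\<lambda>(F, x0, e, i). nat i)") auto

declare chain.simps [simp del]

text \<open>\<open>acoef a k\<close> is the number \<open>a\<^sub>k(k)\<close>.\<close>

fun acoef :: "(nat \<Rightarrow> real) \<Rightarrow> nat \<Rightarrow> real" where
  "acoef a k =
    (if k = 0 then 1 else 1 + a k + (\<Sum>l = 1..<k. acoef a l * a (k - l)))"

declare acoef.simps [simp del]

text \<open>The mean distance \<open>\<integral> \<delta>(y, y') \<mu>(dy')\<close>, which may be infinite for some \<open>y\<close>.\<close>

definition mean_dist :: "'y::metric_space measure \<Rightarrow> 'y \<Rightarrow> ennreal" where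
  "mean_dist \<mu> y = (\<integral>\<^sup>+ y'. ennreal (dist y y') \<partial>\<mu>)"

end

theory Submission
  imports Defs
begin

text \<open>Averaging out the last noise variable turns a function of the past that is Lipschitz with
  weights \<open>c\<close> into one that is Lipschitz with weights \<open>c\<^sub>j\<^sub>+\<^sub>1 + c\<^sub>0 a\<^sub>j\<^sub>+\<^sub>1\<close>. Started from unit weights,
  this recursion yields \<open>c\<^sub>0 = a\<^sub>r(r)\<close> after \<open>r\<close> steps. Conditionally on the past, the
  martingale difference at time \<open>k\<close> is therefore at most \<open>a\<^sub>n\<^sub>-\<^sub>k(n - k) G(\<epsilon>\<^sub>k)\<close>, so the moment
  assumption and the power series of \<open>exp\<close> bound its conditional Laplace transform, and the
  bounds multiply along the martingale. The tail bound is Chernoff's with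
  \<open>t = (1 - 1 / w) / \<delta>\<close>, \<open>w = sqrt (1 + 2 * x * \<delta> / V)\<close>.\<close>

section \<open>Lipschitz weights under repeated averaging\<close>

text \<open>\<open>r\<close> counts the noise variables averaged out so far, from time
  \<open>n\<close> backwards; entry \<open>j\<close> is the value \<open>j\<close> steps before time
  \<open>n - r\<close>.\<close>

fun weight :: "(nat \<Rightarrow> real) \<Rightarrow> nat \<Rightarrow> nat \<Rightarrow> real" where
  "weight a 0 j = 1"
| "weight a (Suc r) j = weight a r (Suc j) + weight a r 0 * a (Suc j)"

text \<open>Every averaging shifts the lags by one. The term created in passing from
  \<open>s\<close> to \<open>Suc s\<close> is shifted \<open>r - s - 1\<close> further times, which
  brings its argument of \<open>a\<close> to \<open>r - s + j\<close>.\<close>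

lemma weight_eq_sum: "weight a r j = 1 + (\<Sum>s<r. weight a s 0 * a (r - s + j))"
proof (induction r arbitrary: j)
  case (Suc r)
  have "(\<Sum>s<r. weight a s 0 * a (Suc r - s + j)) = (\<Sum>s<r. weight a s 0 * a (r - s + Suc j))"
    by (intro sum.cong) (auto simp: Suc_diff_le)
  with Suc.IH[of "Suc j"] show ?case by simp
qed simp

text \<open>At \<open>j = 0\<close> the unrolled recursion has a term for \<open>s = 0\<close>,
  which is \<open>a k\<close> because \<open>acoef a 0 = 1\<close>; it is the isolated summand in
  the definition of \<open>acoef\<close>.\<close>

lemma weight_zero_eq_acoef: "weight a k 0 = acoef a k"
proof (induction k rule: less_induct)
  case (less k)
  show ?case
  proof (cases k)
    case (Suc m)
    have "weight a k 0 = 1 + (\<Sum>s<k. acoef a s * a (k - s))"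
      using less.IH by (simp add: weight_eq_sum[of a k])
    also have "\<dots> = 1 + acoef a 0 * a k + (\<Sum>s = 1..<k. acoef a s * a (k - s))"
      using Suc by (simp add: lessThan_atLeast0 sum.atLeast_Suc_lessThan)
    also have "acoef a 0 = 1"
      by (simp add: acoef.simps)
    also have "1 + 1 * a k + (\<Sum>s = 1..<k. acoef a s * a (k - s)) = acoef a k"
      using Suc by (subst (2) acoef.simps) simp
    finally show ?thesis .
  qed (simp add: acoef.simps)
qed

lemma weight_ge_1:
  assumes "\<And>i. i \<ge> 1 \<Longrightarrow> a i \<ge> 0"
  shows "weight a r j \<ge> 1"
proof (induction r arbitrary: j)
  case (Suc r)
  have "0 \<le> weight a r 0 * a (Suc j)"
    using assms[of "Suc j"] Suc.IH[of 0] by simp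
  with Suc.IH[of "Suc j"] show ?case by simp
qed simp

text \<open>Lets the single scale \<open>M * acoef a (n - 1)\<close> dominate the scales of the
  martingale differences at all times.\<close>

lemma weight_mono:
  assumes "\<And>i. i \<ge> 1 \<Longrightarrow> a i \<ge> 0" "r \<le> r'"
  shows "weight a r j \<le> weight a r' j"
proof -
  have "weight a r j \<le> weight a (Suc r) j" for r j
  proof (induction r arbitrary: j)
    case (Suc r)
    show ?case
      \<comment> \<open>The instances stop the unfolding after one level, so that both sides still
        contain weights to which the induction hypothesis applies.\<close>
      unfolding weight.simps(2)[of a "Suc r"] weight.simps(2)[of a r j]
      using Suc.IH[of "Suc j"] Suc.IH[of 0] assms(1)[of "Suc j"]
      by (intro add_mono mult_right_mono) auto
  qed (use assms(1) in auto)
  then show ?thesis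
    using assms(2) by (rule lift_Suc_mono_le[of "\<lambda>r. weight a r j"])
qed

section \<open>Bernstein moment conditions: Laplace transform and tail\<close>

text \<open>In \<open>exp y \<le> 1 + y + R y\<close> the linear term has mean zero. The factorials
  in the moment bounds cancel those in the series \<open>R\<close>, leaving a geometric series of
  ratio \<open>t * b\<close> and sum \<open>B\<close>; finally
  \<open>1 + B \<le> exp B\<close>.\<close>

lemma (in prob_space) bernstein_mgf:
  fixes D :: "'a \<Rightarrow> real"
  assumes int: "integrable M D" and centered: "expectation D = 0"
    and moments: "\<And>l. l \<ge> 2 \<Longrightarrow>
      (\<integral>\<^sup>+x. ennreal \<bar>D x\<bar> ^ l \<partial>M) \<le> ennreal (fact l / 2 * v * b ^ (l - 2))"
    and nonneg: "v \<ge> 0" "b \<ge> 0" "t \<ge> 0" and tb: "t * b < 1"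
  shows "(\<integral>\<^sup>+x. ennreal (exp (t * D x)) \<partial>M) \<le> ennreal (exp (t\<^sup>2 * v / (2 * (1 - t * b))))"
proof -
  note [measurable] = borel_measurable_integrable[OF int]
  define B where "B = t\<^sup>2 * v / (2 * (1 - t * b))"
  have B: "B \<ge> 0" using nonneg tb by (simp add: B_def)
  \<comment> \<open>Absolute values make all terms nonnegative, so series and integral can be
    exchanged before any integrability is known.\<close>
  define R where "R y = (\<Sum>l. \<bar>y\<bar> ^ (l + 2) / fact (l + 2))" for y :: real
  have exp_sums: "(\<lambda>l. y ^ (l + 2) / fact (l + 2)) sums (exp y - 1 - y)" for y :: real
    using sums_split_initial_segment[OF exp_converges[of y], of 2]
    by (simp add: field_simps numeral_2_eq_2)
  have summ: "summable (\<lambda>l. \<bar>y\<bar> ^ (l + 2) / fact (l + 2))" for y :: real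
    using exp_sums by (rule sums_summable)
  \<comment> \<open>The closed form serves measurability.\<close>
  have R_eq: "R y = exp \<bar>y\<bar> - 1 - \<bar>y\<bar>" for y
    unfolding R_def using exp_sums by (rule sums_unique[symmetric])
  have R_nonneg: "R y \<ge> 0" for y
    unfolding R_def by (intro suminf_nonneg summ) simp
  have exp_le: "exp y \<le> 1 + y + R y" for y
  proof -
    have "exp y - 1 - y = (\<Sum>l. y ^ (l + 2) / fact (l + 2))"
      using exp_sums by (rule sums_unique)
    also have "\<dots> \<le> R y"
      unfolding R_def
    proof (intro suminf_le summ)
      fix l
      have "y ^ (l + 2) \<le> \<bar>y\<bar> ^ (l + 2)" by (metis abs_ge_self power_abs)
      then show "y ^ (l + 2) / fact (l + 2) \<le> \<bar>y\<bar> ^ (l + 2) / fact (l + 2)"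
        by (intro divide_right_mono) auto
    qed (use exp_sums in \<open>rule sums_summable\<close>)
    finally show ?thesis by simp
  qed
  have [measurable]: "(\<lambda>x. R (t * D x)) \<in> borel_measurable M"
    unfolding R_eq by measurable
  have "(\<integral>\<^sup>+x. ennreal (R (t * D x)) \<partial>M)
      = (\<integral>\<^sup>+x. (\<Sum>l. ennreal (\<bar>t * D x\<bar> ^ (l + 2) / fact (l + 2))) \<partial>M)"
    unfolding R_def by (intro nn_integral_cong suminf_ennreal2[symmetric] summ) auto
  also have "\<dots> = (\<Sum>l. \<integral>\<^sup>+x. ennreal (\<bar>t * D x\<bar> ^ (l + 2) / fact (l + 2)) \<partial>M)"
    by (rule nn_integral_suminf) measurable
  also have "\<dots> \<le> (\<Sum>l. ennreal (t\<^sup>2 * v / 2 * (t * b) ^ l))"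
  proof (rule suminf_le)
    fix l
    have "(\<integral>\<^sup>+x. ennreal (\<bar>t * D x\<bar> ^ (l + 2) / fact (l + 2)) \<partial>M)
        = (\<integral>\<^sup>+x. ennreal (t ^ (l + 2) / fact (l + 2)) * ennreal \<bar>D x\<bar> ^ (l + 2) \<partial>M)"
      using nonneg by (intro nn_integral_cong)
        (auto simp del: power_Suc power_add_numeral add_2_eq_Suc' fact_Suc
          simp: abs_mult power_mult_distrib ennreal_power ennreal_mult[symmetric])
    also have "\<dots> = ennreal (t ^ (l + 2) / fact (l + 2)) * (\<integral>\<^sup>+x. ennreal \<bar>D x\<bar> ^ (l + 2) \<partial>M)"
      by (rule nn_integral_cmult) measurable
    also have "\<dots> \<le> ennreal (t ^ (l + 2) / fact (l + 2)) * ennreal (fact (l + 2) / 2 * v * b ^ l)"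
      using moments[of "l + 2"] by (intro mult_left_mono) auto
    also have "\<dots> = ennreal (t ^ (l + 2) / fact (l + 2) * (fact (l + 2) / 2 * v * b ^ l))"
      using nonneg by (intro ennreal_mult[symmetric]) auto
    also have "t ^ (l + 2) / fact (l + 2) * (fact (l + 2) / 2 * v * b ^ l)
        = t\<^sup>2 * v / 2 * (t * b) ^ l"
      by (simp del: fact_Suc add_2_eq_Suc' add: power_add power_mult_distrib)
    finally show "(\<integral>\<^sup>+x. ennreal (\<bar>t * D x\<bar> ^ (l + 2) / fact (l + 2)) \<partial>M)
        \<le> ennreal (t\<^sup>2 * v / 2 * (t * b) ^ l)" .
  qed auto
  also have "\<dots> = ennreal B"
  proof (rule suminf_ennreal_eq)
    show "0 \<le> t\<^sup>2 * v / 2 * (t * b) ^ l" for l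
      using nonneg by simp
    show "(\<lambda>l. t\<^sup>2 * v / 2 * (t * b) ^ l) sums B"
      using sums_mult[OF geometric_sums[of "t * b"], of "t\<^sup>2 * v / 2"] nonneg tb
      by (simp add: B_def)
  qed
  finally have R_bound: "(\<integral>\<^sup>+x. ennreal (R (t * D x)) \<partial>M) \<le> ennreal B" .
  \<comment> \<open>The bound on the nonnegative integral supplies integrability, so that Bochner
    integrals can be split from here on.\<close>
  then have int_R: "integrable M (\<lambda>x. R (t * D x))"
    by (intro integrableI_nonneg) (auto simp: R_nonneg intro: le_less_trans)
  have "ennreal (\<integral>x. R (t * D x) \<partial>M) \<le> ennreal B"
    using R_bound by (subst nn_integral_eq_integral[symmetric]) (auto simp: R_nonneg int_R)
  then have ER: "(\<integral>x. R (t * D x) \<partial>M) \<le> B"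
    using B by simp
  have int_sum: "integrable M (\<lambda>x. 1 + t * D x + R (t * D x))"
    using int int_R by auto
  have "(\<integral>\<^sup>+x. ennreal (exp (t * D x)) \<partial>M) \<le> (\<integral>\<^sup>+x. ennreal (1 + t * D x + R (t * D x)) \<partial>M)"
    by (intro nn_integral_mono ennreal_leI exp_le)
  also have "\<dots> = ennreal (\<integral>x. 1 + t * D x + R (t * D x) \<partial>M)"
    using order.trans[OF exp_ge_zero exp_le]
    by (intro nn_integral_eq_integral int_sum) auto
  also have "(\<integral>x. 1 + t * D x + R (t * D x) \<partial>M) = 1 + (\<integral>x. R (t * D x) \<partial>M)"
    using int int_R centered by (simp add: prob_space)
  also have "\<dots> \<le> exp B"
    using ER exp_ge_add_one_self[of B] by linarith
  finally show ?thesis by (simp add: B_def ennreal_leI)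
qed

text \<open>The comparison rests on \<open>sqrt (1 + 2 * q) \<le> 1 + q\<close> with
  \<open>q = x * \<delta> / V\<close>.\<close>

lemma exp_exponent_le:
  fixes V \<delta> x :: real
  assumes "V \<ge> 0" "\<delta> > 0" "x > 0"
  shows "exp (- x\<^sup>2 / (V * (1 + sqrt (1 + 2 * x * \<delta> / V)) + x * \<delta>))
        \<le> exp (- x\<^sup>2 / (2 * (V + x * \<delta>)))"
proof -
  define q where "q = x * \<delta> / V"
  \<comment> \<open>Only an inequality: for \<open>V = 0\<close> the division gives
    \<open>q = 0\<close>, while \<open>x * \<delta>\<close> stays positive.\<close>
  have q: "q \<ge> 0" and qV: "V * q \<le> x * \<delta>"
    using assms by (auto simp: q_def)
  have "sqrt (1 + 2 * q) \<le> 1 + q"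
    using q by (intro real_le_lsqrt) (auto simp: power2_eq_square algebra_simps)
  then have "V * (1 + sqrt (1 + 2 * q)) \<le> V * (2 + q)"
    using assms by (intro mult_left_mono) auto
  then have "V * (1 + sqrt (1 + 2 * q)) + x * \<delta> \<le> 2 * (V + x * \<delta>)"
    using qV by (simp add: algebra_simps)
  moreover have "0 < V * (1 + sqrt (1 + 2 * q)) + x * \<delta>"
    using assms q by (intro add_nonneg_pos mult_nonneg_nonneg) auto
  moreover have "0 < V + x * \<delta>"
    using assms by (simp add: add_nonneg_pos)
  ultimately have "x\<^sup>2 / (2 * (V + x * \<delta>)) \<le> x\<^sup>2 / (V * (1 + sqrt (1 + 2 * q)) + x * \<delta>)"
    by (intro divide_left_mono) (auto intro!: mult_pos_pos)
  then show ?thesis by (simp add: q_def mult.assoc)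
qed

text \<open>With \<open>s = 1 - t * \<delta>\<close>, Chernoff's exponent is \<open>V / (2 *
  \<delta>\<^sup>2) * (1 / s - 2 + s) - x * (1 - s) / \<delta>\<close>. For \<open>V > 0\<close> it
  is minimal where \<open>1 / s\<^sup>2 = 1 + 2 * x * \<delta> / V\<close>, so the \<open>t\<close>
  chosen below is optimal.\<close>

lemma (in prob_space) bernstein_tail:
  fixes S :: "'a \<Rightarrow> real"
  assumes [measurable]: "S \<in> borel_measurable M"
    and pos: "V \<ge> 0" "\<delta> > 0" "x > 0"
    and mgf: "\<And>t. t \<in> {0..<inverse \<delta>} \<Longrightarrow>
      (\<integral>\<^sup>+\<omega>. ennreal (exp (t * S \<omega>)) \<partial>M) \<le> ennreal (exp (t\<^sup>2 * V / (2 * (1 - t * \<delta>))))"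
  shows "prob {\<omega> \<in> space M. S \<omega> \<ge> x}
    \<le> exp (- x\<^sup>2 / (V * (1 + sqrt (1 + 2 * x * \<delta> / V)) + x * \<delta>))"
proof -
  have chernoff: "prob {\<omega> \<in> space M. S \<omega> \<ge> x} \<le> exp (t\<^sup>2 * V / (2 * (1 - t * \<delta>)) - t * x)"
    if t: "t \<in> {0..<inverse \<delta>}" for t
  proof -
    have "ennreal (exp (t * x)) * emeasure M {\<omega> \<in> space M. S \<omega> \<ge> x}
        = (\<integral>\<^sup>+\<omega>. ennreal (exp (t * x)) * indicator {\<omega> \<in> space M. S \<omega> \<ge> x} \<omega> \<partial>M)"
      by (rule nn_integral_cmult_indicator[symmetric]) measurable
    also have "\<dots> \<le> (\<integral>\<^sup>+\<omega>. ennreal (exp (t * S \<omega>)) \<partial>M)"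
      using t by (intro nn_integral_mono)
        (auto simp: indicator_def intro!: ennreal_leI mult_left_mono)
    also note mgf[OF t]
    finally have "exp (t * x) * prob {\<omega> \<in> space M. S \<omega> \<ge> x} \<le> exp (t\<^sup>2 * V / (2 * (1 - t * \<delta>)))"
      by (simp add: emeasure_eq_measure ennreal_mult[symmetric])
    then show ?thesis
      by (simp add: exp_diff field_simps)
  qed
  show ?thesis
  proof (cases "V = 0")
    case True
    \<comment> \<open>Here \<open>2 * x * \<delta> / V = 0\<close>, and the bound is the limit of Chernoff's at the open end \<open>1 / \<delta>\<close>.\<close>
    have "((\<lambda>t. exp (- (t * x))) \<longlongrightarrow> exp (- (inverse \<delta> * x))) (at_left (inverse \<delta>))"
      by (intro tendsto_intros)
    moreover have "\<forall>\<^sub>F t in at_left (inverse \<delta>). prob {\<omega> \<in> space M. S \<omega> \<ge> x} \<le> exp (- (t * x))"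
    proof (rule eventually_mono)
      show "\<forall>\<^sub>F t in at_left (inverse \<delta>). t \<in> {0<..<inverse \<delta>}"
        using pos(2) by (intro eventually_at_left_real) simp
      show "prob {\<omega> \<in> space M. S \<omega> \<ge> x} \<le> exp (- (t * x))" if "t \<in> {0<..<inverse \<delta>}" for t
        using chernoff[of t] that by (simp add: True)
    qed
    ultimately have "prob {\<omega> \<in> space M. S \<omega> \<ge> x} \<le> exp (- (inverse \<delta> * x))"
      by (intro tendsto_lowerbound) auto
    also have "- (inverse \<delta> * x) = - x\<^sup>2 / (x * \<delta>)"
      using pos by (simp add: field_simps power2_eq_square)
    finally show ?thesis by (simp add: True)
  next
    case False
    define w where "w = sqrt (1 + 2 * x * \<delta> / V)"
    have V: "V > 0" using False pos by simp
    have w2: "w\<^sup>2 = 1 + 2 * x * \<delta> / V" using pos V by (simp add: w_def)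
    have w: "w > 1" using pos V by (simp add: w_def)
    \<comment> \<open>Solving for \<open>x\<close> turns the exponent into a rational function of
      \<open>w\<close>, free of square roots.\<close>
    have x_eq: "x = V * (w\<^sup>2 - 1) / (2 * \<delta>)"
      using pos V by (simp add: w2)
    define t where "t = (1 - 1 / w) / \<delta>"
    have t: "t \<in> {0..<inverse \<delta>}"
      using w pos by (simp add: t_def field_simps)
    have td: "1 - t * \<delta> = 1 / w" using pos by (simp add: t_def)
    have "t\<^sup>2 * V / (2 * (1 - t * \<delta>)) - t * x = - V * (w - 1)\<^sup>2 / (2 * \<delta>\<^sup>2)"
      unfolding td x_eq using w pos
      by (simp add: t_def field_simps power2_eq_square)
    \<comment> \<open>Since \<open>w\<^sup>2 - 1 = (w - 1) * (w + 1)\<close>, the factor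
      \<open>(w - 1)\<^sup>2\<close> can be traded for \<open>x\<^sup>2\<close>; expanding
      \<open>(1 + w)\<^sup>2\<close> then recovers the stated denominator.\<close>
    also have "\<dots> = - x\<^sup>2 / (V * (1 + w)\<^sup>2 / 2)"
      unfolding x_eq using w pos V
      by (simp add: field_simps) (simp add: power2_eq_square algebra_simps)
    also have "V * (1 + w)\<^sup>2 / 2 = V * (1 + w) + x * \<delta>"
      unfolding x_eq using pos by (simp add: field_simps power2_eq_square)
    finally show ?thesis using chernoff[OF t] by (simp add: w_def)
  qed
qed

section \<open>Lipschitz functions of one noise variable\<close>

lemma borel_measurable_mean_dist [measurable]:
  fixes \<mu> :: "'y::polish_space measure"
  assumes "prob_space \<mu>" and [measurable_cong]: "sets \<mu> = sets borel"
  shows "mean_dist \<mu> \<in> borel_measurable borel"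
proof -
  interpret prob_space \<mu> by fact
  show ?thesis
    unfolding mean_dist_def by measurable
qed

text \<open>Averaging the Lipschitz bound over \<open>y'\<close> gives the deviation bound at every
  \<open>y\<close>, also where the mean distance is infinite. The second moment serves the
  integrability of \<open>u\<close>.\<close>

lemma lipschitz_deviation:
  fixes \<mu> :: "'y::polish_space measure" and u :: "'y \<Rightarrow> real"
  assumes prob: "prob_space \<mu>" and [measurable_cong]: "sets \<mu> = sets borel"
    and moment: "(\<integral>\<^sup>+y. mean_dist \<mu> y ^ 2 \<partial>\<mu>) < \<infinity>"
    and u [measurable]: "u \<in> borel_measurable borel"
    and lip: "\<And>y y'. \<bar>u y - u y'\<bar> \<le> c * dist y y'" and c: "c \<ge> 0"
  shows "integrable \<mu> u" "ennreal \<bar>u y - (\<integral>y'. u y' \<partial>\<mu>)\<bar> \<le> ennreal c * mean_dist \<mu> y"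
proof -
  interpret prob_space \<mu> by fact
  \<comment> \<open>A finite second moment excludes that \<open>mean_dist\<close> is infinite
    everywhere; one point of finite mean distance is enough to dominate \<open>u\<close>.\<close>
  obtain y0 where y0: "mean_dist \<mu> y0 \<noteq> \<infinity>"
  proof (rule ccontr)
    assume "\<not> thesis"
    then have "mean_dist \<mu> y = \<infinity>" for y using that by blast
    then show False using moment by (simp add: emeasure_space_1 ennreal_top_mult)
  qed
  have "integrable \<mu> (\<lambda>y. dist y0 y)"
    using y0 by (intro integrableI_nonneg) (auto simp: mean_dist_def less_top)
  then have "integrable \<mu> (\<lambda>y. \<bar>u y0\<bar> + c * dist y0 y)"
    by simp
  then show int: "integrable \<mu> u"
  proof (rule Bochner_Integration.integrable_bound)
    have "norm (u y) \<le> norm (\<bar>u y0\<bar> + c * dist y0 y)" for y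
      using lip[of y0 y] c by (auto simp: abs_if split: if_splits)
    then show "AE y in \<mu>. norm (u y) \<le> norm (\<bar>u y0\<bar> + c * dist y0 y)" by simp
  qed measurable
  have "u y - (\<integral>y'. u y' \<partial>\<mu>) = (\<integral>y'. u y - u y' \<partial>\<mu>)"
    using int by (simp add: prob_space)
  then have "ennreal \<bar>u y - (\<integral>y'. u y' \<partial>\<mu>)\<bar> \<le> (\<integral>\<^sup>+y'. ennreal \<bar>u y - u y'\<bar> \<partial>\<mu>)"
    using integral_norm_bound_ennreal[of \<mu> "\<lambda>y'. u y - u y'"] int
    by (simp add: prob_space)
  also have "\<dots> \<le> (\<integral>\<^sup>+y'. ennreal c * ennreal (dist y y') \<partial>\<mu>)"
    using lip c by (intro nn_integral_mono) (simp add: ennreal_mult[symmetric] ennreal_leI)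
  also have "\<dots> = ennreal c * mean_dist \<mu> y"
    unfolding mean_dist_def by (rule nn_integral_cmult) measurable
  finally show "ennreal \<bar>u y - (\<integral>y'. u y' \<partial>\<mu>)\<bar> \<le> ennreal c * mean_dist \<mu> y" .
qed

text \<open>A deviation of at most \<open>c\<close> times the mean distance has its
  \<open>l\<close>-th moment scaled by \<open>c ^ l = c\<^sup>2 * c ^ (l - 2)\<close>. Bernstein's
  parameters \<open>v\<close> and \<open>M\<close> thus turn into \<open>c\<^sup>2 * v\<close> and
  \<open>c * M\<close>, which explains the squares in \<open>V\<close> and the factor in
  \<open>\<delta>\<close>.\<close>

lemma lipschitz_noise_mgf:
  fixes \<mu> :: "'y::polish_space measure" and u :: "'y \<Rightarrow> real"
  assumes prob: "prob_space \<mu>" and sets [measurable_cong]: "sets \<mu> = sets borel"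
    and moments: "\<And>l. l \<ge> 2 \<Longrightarrow>
      (\<integral>\<^sup>+y. mean_dist \<mu> y ^ l \<partial>\<mu>) \<le> ennreal (fact l / 2 * v * M ^ (l - 2))"
    and u [measurable]: "u \<in> borel_measurable borel"
    and lip: "\<And>y y'. \<bar>u y - u y'\<bar> \<le> c * dist y y'" and c: "c \<ge> 0"
    and nonneg: "v \<ge> 0" "M \<ge> 0" "t \<ge> 0" and small: "t * (c * M) < 1"
  shows "(\<integral>\<^sup>+y. ennreal (exp (t * (u y - (\<integral>y'. u y' \<partial>\<mu>)))) \<partial>\<mu>)
    \<le> ennreal (exp (t\<^sup>2 * (c\<^sup>2 * v) / (2 * (1 - t * (c * M)))))"
proof -
  interpret prob_space \<mu> by fact
  note [measurable] = borel_measurable_mean_dist[OF prob sets]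
  have fin: "(\<integral>\<^sup>+y. mean_dist \<mu> y ^ 2 \<partial>\<mu>) < \<infinity>"
    using moments[of 2] by (auto intro: le_less_trans)
  note dev = lipschitz_deviation[OF prob sets fin u lip c]
  show ?thesis
  proof (rule bernstein_mgf)
    show "integrable \<mu> (\<lambda>y. u y - (\<integral>y'. u y' \<partial>\<mu>))"
      using dev(1) by simp
    show "(\<integral>y. u y - (\<integral>y'. u y' \<partial>\<mu>) \<partial>\<mu>) = 0"
      using dev(1) by (simp add: prob_space)
    show "(\<integral>\<^sup>+y. ennreal \<bar>u y - (\<integral>y'. u y' \<partial>\<mu>)\<bar> ^ l \<partial>\<mu>)
        \<le> ennreal (fact l / 2 * (c\<^sup>2 * v) * (c * M) ^ (l - 2))" if l: "l \<ge> 2" for l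
    proof -
      have "(\<integral>\<^sup>+y. ennreal \<bar>u y - (\<integral>y'. u y' \<partial>\<mu>)\<bar> ^ l \<partial>\<mu>)
          \<le> (\<integral>\<^sup>+y. ennreal c ^ l * mean_dist \<mu> y ^ l \<partial>\<mu>)"
        unfolding power_mult_distrib[symmetric]
        by (intro nn_integral_mono power_mono dev(2)) auto
      also have "\<dots> = ennreal c ^ l * (\<integral>\<^sup>+y. mean_dist \<mu> y ^ l \<partial>\<mu>)"
        by (rule nn_integral_cmult) measurable
      also have "\<dots> \<le> ennreal (c ^ l) * ennreal (fact l / 2 * v * M ^ (l - 2))"
        using moments[OF l] c by (auto simp: ennreal_power intro!: mult_left_mono)
      also have "\<dots> = ennreal (c ^ l * (fact l / 2 * v * M ^ (l - 2)))"
        using c nonneg by (intro ennreal_mult[symmetric]) auto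
      also have "c ^ l = c\<^sup>2 * c ^ (l - 2)"
        using l by (metis le_add_diff_inverse power_add)
      finally show ?thesis by (simp add: power_mult_distrib mult_ac)
    qed
  qed (use nonneg c small in auto)
qed

section \<open>Lipschitz functions of the past, and the chain as a Markov recursion\<close>

text \<open>With sums in \<open>ennreal\<close>, two pasts at infinite weighted distance impose no
  condition, so that weights bounded below, such as the initial unit weights, make sense.\<close>

definition weighted_lipschitz ::
  "(nat \<Rightarrow> real) \<Rightarrow> ((nat \<Rightarrow> 'x::metric_space) \<Rightarrow> real) \<Rightarrow> bool"
where
  "weighted_lipschitz c g \<longleftrightarrow>
    (\<forall>z z'. ennreal \<bar>g z - g z'\<bar> \<le> (\<Sum>j. ennreal (c j * dist (z j) (z' j))))"

lemma suminf_ennreal_split_head: "(\<Sum>j. f j) = f 0 + (\<Sum>j. f (Suc j))" for f :: "nat \<Rightarrow> ennreal"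
proof (rule sums_unique[symmetric])
  have "(\<lambda>n. sum f {..<Suc n}) \<longlonglongrightarrow> f 0 + (\<Sum>j. f (Suc j))"
    unfolding sum.lessThan_Suc_shift
    by (intro tendsto_add tendsto_const summable_LIMSEQ) auto
  then show "f sums (f 0 + (\<Sum>j. f (Suc j)))"
    unfolding sums_def by (rule LIMSEQ_imp_Suc)
qed

lemma weighted_lipschitz_case_nat:
  assumes "weighted_lipschitz c g"
  shows "ennreal \<bar>g (case_nat x z) - g (case_nat x' z')\<bar>
    \<le> ennreal (c 0 * dist x x') + (\<Sum>j. ennreal (c (Suc j) * dist (z j) (z' j)))"
  using assms[unfolded weighted_lipschitz_def, rule_format, of "case_nat x z" "case_nat x' z'"]
  by (subst (asm) suminf_ennreal_split_head) simp

text \<open>The state of the recursion is its whole past, newest value first.\<close>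

definition past ::
  "(nat \<Rightarrow> (nat \<Rightarrow> 'x) \<Rightarrow> 'y \<Rightarrow> 'x) \<Rightarrow> (int \<Rightarrow> 'x) \<Rightarrow> nat \<Rightarrow> (nat \<Rightarrow> 'y) \<Rightarrow> nat \<Rightarrow> 'x"
where
  "past F x0 k e = (\<lambda>j. chain F x0 e (int k - int j))"

lemma past_0: "past F x0 0 e = (\<lambda>j. x0 (- int j))"
  by (simp add: past_def chain.simps)

lemma past_Suc: "past F x0 (Suc k) e = case_nat (F (Suc k) (past F x0 k e) (e (Suc k))) (past F x0 k e)"
proof
  show "past F x0 (Suc k) e j
      = case_nat (F (Suc k) (past F x0 k e) (e (Suc k))) (past F x0 k e) j" for j
  proof (cases j)
    case 0
    have "nat (1 + int k) = Suc k" by simp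
    with 0 show ?thesis
      by (simp add: past_def chain.simps[of F x0 e "1 + int k"])
  qed (simp add: past_def)
qed

text \<open>Dependence on the noise at times \<open>1..k\<close> alone is what makes the state at
  time \<open>k\<close> independent of the next noise.\<close>

lemma past_cong: "(\<And>i. i \<in> {1..k} \<Longrightarrow> e i = e' i) \<Longrightarrow> past F x0 k e = past F x0 k e'"
  by (induction k) (auto simp: past_0 past_Suc)

section \<open>Joint law of the state and the next noise\<close>

locale contractive_chain = prob_space P
  for P :: "'w measure"
    and \<epsilon> :: "nat \<Rightarrow> 'w \<Rightarrow> 'y::polish_space"
    and F :: "nat \<Rightarrow> (nat \<Rightarrow> 'x::polish_space) \<Rightarrow> 'y \<Rightarrow> 'x"
    and x0 :: "int \<Rightarrow> 'x"
    and a :: "nat \<Rightarrow> real" +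
  assumes indep: "indep_vars (\<lambda>_. borel) \<epsilon> {1..}"
    and F_meas: "\<And>m. m \<ge> 1 \<Longrightarrow>
      (\<lambda>(x, y). F m x y) \<in> measurable ((\<Pi>\<^sub>M j\<in>UNIV. borel) \<Otimes>\<^sub>M borel) borel"
    and a_nonneg: "\<And>i. i \<ge> 1 \<Longrightarrow> a i \<ge> 0"
    and contraction: "\<And>m x x'. m \<ge> 1 \<Longrightarrow>
      (\<integral>\<^sup>+ \<omega>. ennreal (dist (F m x (\<epsilon> m \<omega>)) (F m x' (\<epsilon> m \<omega>))) \<partial>P)
        \<le> (\<Sum>j. ennreal (a (Suc j) * dist (x j) (x' j)))"
    and F_lip: "\<And>m x y y'. m \<ge> 1 \<Longrightarrow> dist (F m x y) (F m x y') \<le> dist y y'"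
begin

abbreviation noise :: "nat \<Rightarrow> 'y measure" where
  "noise k \<equiv> distr P borel (\<epsilon> k)"

abbreviation states :: "(nat \<Rightarrow> 'x) measure" where
  "states \<equiv> \<Pi>\<^sub>M j\<in>UNIV. borel"

abbreviation state :: "nat \<Rightarrow> 'w \<Rightarrow> nat \<Rightarrow> 'x" where
  "state k \<omega> \<equiv> past F x0 k (\<lambda>i. \<epsilon> i \<omega>)"

text \<open>Independence is assumed from time 1 on; writing times as \<open>Suc k\<close> builds
  this restriction into the statements.\<close>

lemma rv [measurable]: "\<epsilon> (Suc k) \<in> borel_measurable P"
  using indep by (simp add: indep_vars_def)

lemma prob_space_noise: "prob_space (noise (Suc k))"
  by (rule prob_space_distr) measurable

lemma measurable_F [measurable (raw)]:
  assumes "X \<in> measurable N states" "Y \<in> borel_measurable N"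
  shows "(\<lambda>w. F (Suc k) (X w) (Y w)) \<in> borel_measurable N"
  using measurable_compose[OF measurable_Pair[OF assms] F_meas[of "Suc k"]] by simp

text \<open>The index set \<open>I\<close> does not depend on \<open>k\<close>, so that the
  induction stays in one product space.\<close>

lemma measurable_past:
  "{1..k} \<subseteq> I \<Longrightarrow> past F x0 k \<in> measurable (\<Pi>\<^sub>M i\<in>I. borel) states"
proof (induction k)
  case 0
  show ?case unfolding past_0 by (rule measurable_const) (simp add: space_PiM)
next
  case (Suc k)
  then have "{1..k} \<subseteq> I" and [simp]: "Suc k \<in> I" by auto
  then have [measurable]: "past F x0 k \<in> measurable (\<Pi>\<^sub>M i\<in>I. borel) states"
    using Suc.IH by blast
  show ?case unfolding past_Suc by measurable
qed

lemma state_eq: "state k \<omega> = past F x0 k (restrict (\<lambda>i. \<epsilon> i \<omega>) {1..k})"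
  by (rule past_cong) simp

lemma measurable_restrict_noise:
  "I \<subseteq> {1..} \<Longrightarrow> (\<lambda>\<omega>. restrict (\<lambda>i. \<epsilon> i \<omega>) I) \<in> measurable P (\<Pi>\<^sub>M i\<in>I. borel)"
  using indep by (intro measurable_restrict) (auto simp: indep_vars_def)

lemma measurable_state [measurable]: "state k \<in> measurable P states"
  unfolding state_eq[abs_def]
  by (rule measurable_compose[OF measurable_restrict_noise measurable_past]) auto

abbreviation push :: "nat \<Rightarrow> (nat \<Rightarrow> 'x) \<Rightarrow> 'y \<Rightarrow> nat \<Rightarrow> 'x" where
  "push k z y \<equiv> case_nat (F (Suc k) z y) z"

text \<open>The state is a function of the noise at times \<open>1..k\<close>, and disjoint blocks
  of an independent family are independent; the product of the block laws is pushed forward.\<close>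

lemma joint_distr: "distr P states (state k) \<Otimes>\<^sub>M noise (Suc k)
    = distr P (states \<Otimes>\<^sub>M borel) (\<lambda>\<omega>. (state k \<omega>, \<epsilon> (Suc k) \<omega>))"
proof -
  define I where "I = {1..k}"
  define Q where "Q J = (\<Pi>\<^sub>M i\<in>J. borel :: 'y measure)" for J :: "nat set"
  define E where "E J \<omega> = restrict (\<lambda>i. \<epsilon> i \<omega>) J" for J \<omega>
  have E [measurable]: "E I \<in> measurable P (Q I)" "E {Suc k} \<in> measurable P (Q {Suc k})"
    unfolding E_def Q_def I_def by (rule measurable_restrict_noise, simp)+
  have past [measurable]: "past F x0 k \<in> measurable (Q I) states"
    unfolding Q_def I_def by (rule measurable_past) simp
  have eval [measurable]: "(\<lambda>e. e (Suc k)) \<in> measurable (Q {Suc k}) borel"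
    unfolding Q_def by measurable
  have state: "past F x0 k (E I \<omega>) = state k \<omega>" for \<omega>
    unfolding E_def I_def by (rule state_eq[symmetric])
  have eps: "E {Suc k} \<omega> (Suc k) = \<epsilon> (Suc k) \<omega>" for \<omega>
    by (simp add: E_def)
  \<comment> \<open>The new noise too is taken as a block, with a singleton index set, and read off
    by evaluation at \<open>Suc k\<close>.\<close>
  have "indep_var (Q I) (E I) (Q {Suc k}) (E {Suc k})"
    unfolding Q_def E_def[abs_def] I_def by (rule indep_var_restrict[OF indep]) auto
  then have joint: "distr P (Q I) (E I) \<Otimes>\<^sub>M distr P (Q {Suc k}) (E {Suc k})
      = distr P (Q I \<Otimes>\<^sub>M Q {Suc k}) (\<lambda>\<omega>. (E I \<omega>, E {Suc k} \<omega>))"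
    by (simp add: indep_var_distribution_eq)
  have st: "distr P states (state k) = distr (distr P (Q I) (E I)) states (past F x0 k)"
    by (simp add: distr_distr comp_def state)
  have no: "noise (Suc k) = distr (distr P (Q {Suc k}) (E {Suc k})) borel (\<lambda>e. e (Suc k))"
    by (simp add: distr_distr comp_def eps)
  have fin: "sigma_finite_measure (distr (distr P (Q {Suc k}) (E {Suc k})) borel (\<lambda>e. e (Suc k)))"
    using prob_space_noise[of k] unfolding no by (rule prob_space_imp_sigma_finite)
  have "distr P states (state k) \<Otimes>\<^sub>M noise (Suc k)
      = distr (distr P (Q I) (E I) \<Otimes>\<^sub>M distr P (Q {Suc k}) (E {Suc k})) (states \<Otimes>\<^sub>M borel)
          (\<lambda>(p, q). (past F x0 k p, q (Suc k)))"
    unfolding st no by (intro pair_measure_distr fin) auto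
  also have "\<dots> = distr P (states \<Otimes>\<^sub>M borel) (\<lambda>\<omega>. (state k \<omega>, \<epsilon> (Suc k) \<omega>))"
    unfolding joint by (subst distr_distr) (auto simp: comp_def state eps)
  finally show ?thesis .
qed

text \<open>Integrating over the new noise with the past frozen amounts to conditioning on the
  state; Tonelli's theorem on the product law replaces conditional expectations.\<close>

lemma nn_integral_state_Suc:
  assumes [measurable]: "h \<in> borel_measurable states"
  shows "(\<integral>\<^sup>+\<omega>. h (state (Suc k) \<omega>) \<partial>P)
    = (\<integral>\<^sup>+\<omega>. (\<integral>\<^sup>+y. h (push k (state k \<omega>) y) \<partial>noise (Suc k)) \<partial>P)"
proof -
  interpret N: prob_space "noise (Suc k)" by (rule prob_space_noise)
  have "(\<integral>\<^sup>+\<omega>. h (state (Suc k) \<omega>) \<partial>P)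
      = (\<integral>\<^sup>+(z, y). h (push k z y) \<partial>(distr P states (state k) \<Otimes>\<^sub>M noise (Suc k)))"
    unfolding joint_distr by (subst nn_integral_distr) (auto simp: past_Suc)
  also have "\<dots> = (\<integral>\<^sup>+z. (\<integral>\<^sup>+y. h (push k z y) \<partial>noise (Suc k)) \<partial>distr P states (state k))"
    by (subst N.nn_integral_fst[symmetric]) auto
  also have "\<dots> = (\<integral>\<^sup>+\<omega>. (\<integral>\<^sup>+y. h (push k (state k \<omega>) y) \<partial>noise (Suc k)) \<partial>P)"
    by (rule nn_integral_distr) measurable
  finally show ?thesis .
qed

text \<open>The signed version is Fubini's theorem, hence the integrability premise; it shows that
  averaging out a noise variable preserves the mean.\<close>

lemma integral_state_Suc:
  fixes g :: "(nat \<Rightarrow> 'x) \<Rightarrow> real"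
  assumes [measurable]: "g \<in> borel_measurable states"
    and int: "integrable P (\<lambda>\<omega>. g (state (Suc k) \<omega>))"
  shows "(\<integral>\<omega>. g (state (Suc k) \<omega>) \<partial>P)
    = (\<integral>\<omega>. (\<integral>y. g (push k (state k \<omega>) y) \<partial>noise (Suc k)) \<partial>P)"
proof -
  interpret N: prob_space "noise (Suc k)" by (rule prob_space_noise)
  interpret Z: prob_space "distr P states (state k)" by (rule prob_space_distr) measurable
  interpret ZN: pair_prob_space "distr P states (state k)" "noise (Suc k)" ..
  have "integrable (distr P states (state k) \<Otimes>\<^sub>M noise (Suc k)) (\<lambda>(z, y). g (push k z y))"
    unfolding joint_distr using int by (subst integrable_distr_eq) (auto simp: past_Suc)
  then have "(\<integral>(z, y). g (push k z y) \<partial>(distr P states (state k) \<Otimes>\<^sub>M noise (Suc k)))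
      = (\<integral>z. (\<integral>y. g (push k z y) \<partial>noise (Suc k)) \<partial>distr P states (state k))"
    by (simp add: ZN.integral_fst'[symmetric])
  also have "\<dots> = (\<integral>\<omega>. (\<integral>y. g (push k (state k \<omega>) y) \<partial>noise (Suc k)) \<partial>P)"
    by (rule integral_distr) measurable
  finally show ?thesis
    unfolding joint_distr by (subst (asm) integral_distr) (auto simp: past_Suc)
qed

section \<open>One averaging step and the induction over time\<close>

text \<open>With the past frozen only the newest entry changes, so the weight \<open>c 0\<close>
  alone is picked up; \<open>F_lip\<close> passes from the new value to the noise.\<close>

lemma push_lipschitz:
  assumes "weighted_lipschitz c g" "c 0 \<ge> 0"
  shows "\<bar>g (push k z y) - g (push k z y')\<bar> \<le> c 0 * dist y y'"
proof -
  have "ennreal \<bar>g (push k z y) - g (push k z y')\<bar>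
      \<le> ennreal (c 0 * dist (F (Suc k) z y) (F (Suc k) z y'))"
    using weighted_lipschitz_case_nat[OF assms(1), of "F (Suc k) z y" z "F (Suc k) z y'" z] by simp
  then have "\<bar>g (push k z y) - g (push k z y')\<bar> \<le> c 0 * dist (F (Suc k) z y) (F (Suc k) z y')"
    using assms(2) by simp
  also have "\<dots> \<le> c 0 * dist y y'"
    using F_lip[of "Suc k"] assms(2) by (intro mult_left_mono) auto
  finally show ?thesis .
qed

text \<open>Both pasts are pushed with the same noise. The contraction bounds the mean distance of
  the two new values, which spreads the weight \<open>c 0\<close> over all lags through
  \<open>a\<close>; the old entry \<open>j\<close> now sits at position \<open>Suc j\<close> and
  contributes \<open>c (Suc j)\<close>.\<close>

lemma weighted_lipschitz_average:
  fixes g :: "(nat \<Rightarrow> 'x) \<Rightarrow> real"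
  assumes [measurable]: "g \<in> borel_measurable states" and lip: "weighted_lipschitz c g"
    and c: "\<And>j. c j \<ge> 0"
    and moment: "(\<integral>\<^sup>+y. mean_dist (noise (Suc k)) y ^ 2 \<partial>noise (Suc k)) < \<infinity>"
  shows "weighted_lipschitz (\<lambda>j. c (Suc j) + c 0 * a (Suc j))
    (\<lambda>z. \<integral>y. g (push k z y) \<partial>noise (Suc k))"
  unfolding weighted_lipschitz_def
proof (intro allI)
  fix z z' :: "nat \<Rightarrow> 'x"
  interpret N: prob_space "noise (Suc k)" by (rule prob_space_noise)
  have [measurable]: "z \<in> space states" "z' \<in> space states" by (simp_all add: space_PiM)
  have int: "integrable (noise (Suc k)) (\<lambda>y. g (push k z y))" for z
  proof -
    have [measurable]: "z \<in> space states" by (simp add: space_PiM)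
    show ?thesis
      by (rule lipschitz_deviation(1)[OF prob_space_noise sets_distr moment _
            push_lipschitz[OF lip c] c]) measurable
  qed
  let ?tail = "\<Sum>j. ennreal (c (Suc j) * dist (z j) (z' j))"
  have "ennreal \<bar>(\<integral>y. g (push k z y) \<partial>noise (Suc k)) - (\<integral>y. g (push k z' y) \<partial>noise (Suc k))\<bar>
      = ennreal \<bar>\<integral>y. g (push k z y) - g (push k z' y) \<partial>noise (Suc k)\<bar>"
    using int by simp
  also have "\<dots> \<le> (\<integral>\<^sup>+y. ennreal \<bar>g (push k z y) - g (push k z' y)\<bar> \<partial>noise (Suc k))"
    using integral_norm_bound_ennreal[of "noise (Suc k)" "\<lambda>y. g (push k z y) - g (push k z' y)"]
      int by simp
  also have "\<dots> \<le> (\<integral>\<^sup>+y. ennreal (c 0) * ennreal (dist (F (Suc k) z y) (F (Suc k) z' y)) + ?tail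
      \<partial>noise (Suc k))"
    using c by (intro nn_integral_mono order.trans[OF weighted_lipschitz_case_nat[OF lip]])
      (simp add: ennreal_mult)
  also have "\<dots> = ennreal (c 0) * (\<integral>\<^sup>+y. ennreal (dist (F (Suc k) z y) (F (Suc k) z' y))
      \<partial>noise (Suc k)) + ?tail"
    using N.emeasure_space_1 by (simp add: nn_integral_add nn_integral_cmult)
  also have "\<dots> \<le> ennreal (c 0) * (\<Sum>j. ennreal (a (Suc j) * dist (z j) (z' j))) + ?tail"
    using contraction[of "Suc k" z z']
    by (intro add_mono mult_left_mono) (auto simp: nn_integral_distr)
  also have "\<dots> = (\<Sum>j. ennreal ((c (Suc j) + c 0 * a (Suc j)) * dist (z j) (z' j)))"
    using c a_nonneg
    by (simp flip: ennreal_suminf_cmult ennreal_mult ennreal_plus add: suminf_add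
        algebra_simps)
  finally show "ennreal \<bar>(\<integral>y. g (push k z y) \<partial>noise (Suc k))
      - (\<integral>y. g (push k z' y) \<partial>noise (Suc k))\<bar>
    \<le> (\<Sum>j. ennreal ((c (Suc j) + c 0 * a (Suc j)) * dist (z j) (z' j)))" .
qed

text \<open>Induction on \<open>k\<close>, for all \<open>g\<close> and \<open>r\<close> at once:
  \<open>g\<close> at time \<open>Suc k\<close> is traded for its average \<open>h\<close> at time
  \<open>k\<close>, and \<open>r\<close> for \<open>Suc r\<close>. Integrability is carried along,
  since the centering mean could otherwise be a mere default value. \<open>\<delta>\<close> is any
  common bound for the scales.\<close>

lemma state_integrable_and_mgf:
  fixes g :: "(nat \<Rightarrow> 'x) \<Rightarrow> real"
  assumes "g \<in> borel_measurable states" and "weighted_lipschitz (weight a r) g"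
    and "\<And>i. i \<in> {1..k} \<Longrightarrow> v i \<ge> 0" and M: "M \<ge> 0"
    and "\<And>i l. i \<in> {1..k} \<Longrightarrow> l \<ge> 2 \<Longrightarrow>
      (\<integral>\<^sup>+y. mean_dist (noise i) y ^ l \<partial>noise i) \<le> ennreal (fact l / 2 * v i * M ^ (l - 2))"
    and "\<And>i. i \<in> {1..k} \<Longrightarrow> weight a (r + (k - i)) 0 * M \<le> \<delta>"
    and t: "t \<ge> 0" "t * \<delta> < 1"
  shows "integrable P (\<lambda>\<omega>. g (state k \<omega>)) \<and>
    (\<integral>\<^sup>+\<omega>. ennreal (exp (t * (g (state k \<omega>) - (\<integral>\<omega>. g (state k \<omega>) \<partial>P)))) \<partial>P)
      \<le> ennreal (exp (t\<^sup>2 * (\<Sum>i = 1..k. (weight a (r + (k - i)) 0)\<^sup>2 * v i) / (2 * (1 - t * \<delta>))))"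
  using assms(1,2,3,5,6)
proof (induction k arbitrary: g r)
  case 0
  \<comment> \<open>The initial past is deterministic, so the centered variable vanishes.\<close>
  show ?case by (simp add: past_0 prob_space emeasure_space_1)
next
  case (Suc k)
  note [measurable] = Suc.prems(1) and lip = Suc.prems(2)
  interpret N: prob_space "noise (Suc k)" by (rule prob_space_noise)
  have weight_nonneg: "weight a r j \<ge> 0" for j
    using weight_ge_1[of a r j] a_nonneg by force
  define c where "c = weight a r 0"
  \<comment> \<open>\<open>g\<close> minus this conditional mean is the martingale difference at
    time \<open>Suc k\<close>.\<close>
  define h where "h z = (\<integral>y. g (push k z y) \<partial>noise (Suc k))" for z
  define V where "V = (\<Sum>i = 1..k. (weight a (Suc r + (k - i)) 0)\<^sup>2 * v i)"
  have v: "v (Suc k) \<ge> 0" and cM: "c * M \<le> \<delta>"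
    using Suc.prems(3)[of "Suc k"] Suc.prems(5)[of "Suc k"] by (auto simp: c_def)
  have c: "c \<ge> 0" using weight_nonneg by (simp add: c_def)
  have moments: "(\<integral>\<^sup>+y. mean_dist (noise (Suc k)) y ^ l \<partial>noise (Suc k))
      \<le> ennreal (fact l / 2 * v (Suc k) * M ^ (l - 2))" if "l \<ge> 2" for l
    using Suc.prems(4)[of "Suc k" l] that by simp
  have second: "(\<integral>\<^sup>+y. mean_dist (noise (Suc k)) y ^ 2 \<partial>noise (Suc k)) < \<infinity>"
    using moments[of 2] by (auto intro: le_less_trans)
  \<comment> \<open>The noise at time \<open>i\<close> keeps its coefficient: the rise of
    \<open>r\<close> compensates the drop of \<open>k\<close>.\<close>
  have shift: "Suc r + (k - i) = r + (Suc k - i)" if "i \<in> {1..k}" for i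
    using that by auto
  have h_meas [measurable]: "h \<in> borel_measurable states"
    unfolding h_def by measurable
  have h_lip: "weighted_lipschitz (weight a (Suc r)) h"
    using weighted_lipschitz_average[OF Suc.prems(1) lip weight_nonneg second]
    by (simp add: h_def[abs_def] weight.simps(2)[abs_def])
  have "integrable P (\<lambda>\<omega>. h (state k \<omega>)) \<and>
    (\<integral>\<^sup>+\<omega>. ennreal (exp (t * (h (state k \<omega>) - (\<integral>\<omega>. h (state k \<omega>) \<partial>P)))) \<partial>P)
      \<le> ennreal (exp (t\<^sup>2 * V / (2 * (1 - t * \<delta>))))"
    unfolding V_def
  proof (rule Suc.IH[OF h_meas h_lip])
    show "weight a (Suc r + (k - i)) 0 * M \<le> \<delta>" if "i \<in> {1..k}" for i
      using Suc.prems(5)[of i] that unfolding shift[OF that] by simp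
  qed (use Suc.prems(3,4) in auto)
  then have h_int: "integrable P (\<lambda>\<omega>. h (state k \<omega>))"
    and h_mgf: "(\<integral>\<^sup>+\<omega>. ennreal (exp (t * (h (state k \<omega>) - (\<integral>\<omega>. h (state k \<omega>) \<partial>P)))) \<partial>P)
      \<le> ennreal (exp (t\<^sup>2 * V / (2 * (1 - t * \<delta>))))"
    by auto
  have [measurable]: "z \<in> space states" for z :: "nat \<Rightarrow> 'x"
    by (simp add: space_PiM)
  have u_meas: "(\<lambda>y. g (push k z y)) \<in> borel_measurable borel" for z
    by measurable
  have u_lip: "\<bar>g (push k z y) - g (push k z y')\<bar> \<le> c * dist y y'" for z y y'
    unfolding c_def by (rule push_lipschitz[OF lip weight_nonneg])
  note [measurable] = borel_measurable_mean_dist[OF prob_space_noise sets_distr, of k]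
  have G1: "(\<integral>\<^sup>+y. mean_dist (noise (Suc k)) y \<partial>noise (Suc k)) < \<infinity>"
  proof -
    \<comment> \<open>The moment assumption starts at \<open>l = 2\<close>, so the first moment is
      compared with the second.\<close>
    have le: "m \<le> 1 + m ^ 2" for m :: ennreal
    proof (cases "m \<le> 1")
      case False
      then have "m * 1 \<le> m * m" by (intro mult_left_mono) auto
      then show ?thesis by (simp add: power2_eq_square add_increasing)
    qed (simp add: add_increasing2)
    have "(\<integral>\<^sup>+y. mean_dist (noise (Suc k)) y \<partial>noise (Suc k))
        \<le> (\<integral>\<^sup>+y. 1 + mean_dist (noise (Suc k)) y ^ 2 \<partial>noise (Suc k))"
      by (intro nn_integral_mono le)
    also have "\<dots> = 1 + (\<integral>\<^sup>+y. mean_dist (noise (Suc k)) y ^ 2 \<partial>noise (Suc k))"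
      using N.emeasure_space_1 by (subst nn_integral_add) auto
    also have "\<dots> < \<infinity>" using second by simp
    finally show ?thesis .
  qed
  \<comment> \<open>\<open>g\<close> differs from \<open>h\<close> by at most \<open>c\<close> times
    the mean distance, whose mean over the noise does not depend on the past.\<close>
  have g_int: "integrable P (\<lambda>\<omega>. g (state (Suc k) \<omega>))"
  proof (rule integrableI_bounded)
    have "(\<integral>\<^sup>+y. ennreal \<bar>g (push k z y)\<bar> \<partial>noise (Suc k))
        \<le> ennreal \<bar>h z\<bar> + ennreal c * (\<integral>\<^sup>+y. mean_dist (noise (Suc k)) y \<partial>noise (Suc k))" for z
    proof -
      have "(\<integral>\<^sup>+y. ennreal \<bar>g (push k z y)\<bar> \<partial>noise (Suc k))
          \<le> (\<integral>\<^sup>+y. ennreal \<bar>h z\<bar> + ennreal c * mean_dist (noise (Suc k)) y \<partial>noise (Suc k))"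
      proof (rule nn_integral_mono)
        fix y
        have "ennreal \<bar>g (push k z y)\<bar> \<le> ennreal \<bar>h z\<bar> + ennreal \<bar>g (push k z y) - h z\<bar>"
          by (simp flip: ennreal_plus add: ennreal_leI)
        also have "\<dots> \<le> ennreal \<bar>h z\<bar> + ennreal c * mean_dist (noise (Suc k)) y"
          unfolding h_def
          by (intro add_left_mono
              lipschitz_deviation(2)[OF prob_space_noise sets_distr second u_meas u_lip c])
        finally show "ennreal \<bar>g (push k z y)\<bar>
            \<le> ennreal \<bar>h z\<bar> + ennreal c * mean_dist (noise (Suc k)) y" .
      qed
      then show ?thesis
        using N.emeasure_space_1 by (simp add: nn_integral_add nn_integral_cmult)
    qed
    then have "(\<integral>\<^sup>+\<omega>. ennreal (norm (g (state (Suc k) \<omega>))) \<partial>P)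
        \<le> (\<integral>\<^sup>+\<omega>. ennreal \<bar>h (state k \<omega>)\<bar>
            + ennreal c * (\<integral>\<^sup>+y. mean_dist (noise (Suc k)) y \<partial>noise (Suc k)) \<partial>P)"
      by (subst nn_integral_state_Suc) (auto intro!: nn_integral_mono)
    also have "\<dots> = (\<integral>\<^sup>+\<omega>. ennreal \<bar>h (state k \<omega>)\<bar> \<partial>P)
        + ennreal c * (\<integral>\<^sup>+y. mean_dist (noise (Suc k)) y \<partial>noise (Suc k))"
      by (simp add: nn_integral_add emeasure_space_1)
    also have "\<dots> < \<infinity>"
      using h_int G1 by (simp add: integrable_iff_bounded ennreal_mult_less_top)
    finally show "(\<integral>\<^sup>+\<omega>. ennreal (norm (g (state (Suc k) \<omega>))) \<partial>P) < \<infinity>" .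
  qed measurable
  have mean: "(\<integral>\<omega>. g (state (Suc k) \<omega>) \<partial>P) = (\<integral>\<omega>. h (state k \<omega>) \<partial>P)"
    unfolding h_def using g_int by (rule integral_state_Suc[OF Suc.prems(1)])
  \<comment> \<open>By \<open>mean\<close>, the same constant centers \<open>g\<close> and
    \<open>h\<close>.\<close>
  define m where "m = (\<integral>\<omega>. h (state k \<omega>) \<partial>P)"
  define W where "W = c\<^sup>2 * v (Suc k)"
  have W: "W \<ge> 0" using v by (simp add: W_def)
  have tcM: "t * (c * M) \<le> t * \<delta>"
    using cM t by (intro mult_left_mono)
  \<comment> \<open>Split \<open>g - m\<close> into \<open>(g - h) + (h - m)\<close>: with the past
    frozen the second part is constant, and the first is a centered Lipschitz function of the
    noise.\<close>
  have one_step: "(\<integral>\<^sup>+y. ennreal (exp (t * (g (push k z y) - m))) \<partial>noise (Suc k))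
      \<le> ennreal (exp (t\<^sup>2 * W / (2 * (1 - t * \<delta>)))) * ennreal (exp (t * (h z - m)))" for z
  proof -
    have "(\<integral>\<^sup>+y. ennreal (exp (t * (g (push k z y) - m))) \<partial>noise (Suc k))
        = (\<integral>\<^sup>+y. ennreal (exp (t * (h z - m))) * ennreal (exp (t * (g (push k z y) - h z)))
            \<partial>noise (Suc k))"
      by (intro nn_integral_cong)
        (simp flip: ennreal_mult exp_add add: right_diff_distrib)
    also have "\<dots> = ennreal (exp (t * (h z - m)))
        * (\<integral>\<^sup>+y. ennreal (exp (t * (g (push k z y) - h z))) \<partial>noise (Suc k))"
      by (rule nn_integral_cmult) measurable
    also have "\<dots> \<le> ennreal (exp (t * (h z - m)))
        * ennreal (exp (t\<^sup>2 * W / (2 * (1 - t * (c * M)))))"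
      unfolding h_def W_def using tcM t
      by (intro mult_left_mono lipschitz_noise_mgf[OF prob_space_noise sets_distr moments u_meas
            u_lip c v M]) auto
    \<comment> \<open>Replacing \<open>c * M\<close> by its bound \<open>\<delta>\<close> gives all
      steps the same denominator, so that the exponents add up.\<close>
    also have "\<dots> \<le> ennreal (exp (t * (h z - m))) * ennreal (exp (t\<^sup>2 * W / (2 * (1 - t * \<delta>))))"
      using tcM t W
      by (intro mult_left_mono ennreal_leI) (auto intro!: divide_left_mono mult_pos_pos)
    finally show ?thesis by (simp add: mult.commute)
  qed
  have "(\<integral>\<^sup>+\<omega>. ennreal (exp (t * (g (state (Suc k) \<omega>) - m))) \<partial>P)
      = (\<integral>\<^sup>+\<omega>. (\<integral>\<^sup>+y. ennreal (exp (t * (g (push k (state k \<omega>) y) - m))) \<partial>noise (Suc k)) \<partial>P)"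
    by (rule nn_integral_state_Suc) measurable
  also have "\<dots> \<le> (\<integral>\<^sup>+\<omega>. ennreal (exp (t\<^sup>2 * W / (2 * (1 - t * \<delta>))))
      * ennreal (exp (t * (h (state k \<omega>) - m))) \<partial>P)"
    by (intro nn_integral_mono one_step)
  also have "\<dots> = ennreal (exp (t\<^sup>2 * W / (2 * (1 - t * \<delta>))))
      * (\<integral>\<^sup>+\<omega>. ennreal (exp (t * (h (state k \<omega>) - m))) \<partial>P)"
    by (rule nn_integral_cmult) measurable
  also have "\<dots> \<le> ennreal (exp (t\<^sup>2 * W / (2 * (1 - t * \<delta>))))
      * ennreal (exp (t\<^sup>2 * V / (2 * (1 - t * \<delta>))))"
    using h_mgf by (intro mult_left_mono) (auto simp: m_def)
  also have "\<dots> = ennreal (exp (t\<^sup>2 * (V + W) / (2 * (1 - t * \<delta>))))"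
    by (simp flip: ennreal_mult exp_add add_divide_distrib add: algebra_simps)
  also have "V + W = (\<Sum>i = 1..Suc k. (weight a (r + (Suc k - i)) 0)\<^sup>2 * v i)"
    unfolding V_def W_def c_def using shift by (simp del: add_Suc)
  finally show ?case
    using g_int by (simp add: mean m_def)
qed

end

section \<open>Application to the Lipschitz functional of the trajectory\<close>

text \<open>Provides the measurability of \<open>f\<close> along the past: a bound by coordinate
  distances gives continuity for the product topology.\<close>

lemma continuous_on_coordinate_lipschitz:
  fixes g :: "('i \<Rightarrow> 'x::metric_space) \<Rightarrow> real"
  assumes "\<And>z z'. \<bar>g z - g z'\<bar> \<le> (\<Sum>i\<in>I. dist (z i) (z' i))"
  shows "continuous_on UNIV g"
  unfolding continuous_on_def
proof
  fix z :: "'i \<Rightarrow> 'x"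
  have "((\<lambda>z'. z' i) \<longlongrightarrow> z i) (at z)" for i
    using continuous_on_product_coordinates[of i] by (auto simp: continuous_on_def)
  then have "((\<lambda>z'. \<Sum>i\<in>I. dist (z' i) (z i)) \<longlongrightarrow> (\<Sum>i\<in>I. dist (z i) (z i))) (at z)"
    by (intro tendsto_intros)
  then have "((\<lambda>z'. \<Sum>i\<in>I. dist (z' i) (z i)) \<longlongrightarrow> 0) (at z)"
    by simp
  moreover have "\<forall>\<^sub>F z' in at z. norm (g z' - g z) \<le> (\<Sum>i\<in>I. dist (z' i) (z i))"
    using assms by simp
  ultimately have "((\<lambda>z'. g z' - g z) \<longlongrightarrow> 0) (at z)"
    by (rule Lim_null_comparison[rotated])
  then show "(g \<longlongrightarrow> g z) (at z)"
    by (rule LIM_zero_cancel)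
qed

theorem proposition4p1:
  fixes P :: "'w measure"
    and \<epsilon> :: "nat \<Rightarrow> 'w \<Rightarrow> 'y::polish_space"
    and F :: "nat \<Rightarrow> (nat \<Rightarrow> 'x::polish_space) \<Rightarrow> 'y \<Rightarrow> 'x"
    and x0 :: "int \<Rightarrow> 'x"
    and a :: "nat \<Rightarrow> real"
    and n :: nat
    and f :: "(nat \<Rightarrow> 'x) \<Rightarrow> real"
    and X :: "nat \<Rightarrow> 'w \<Rightarrow> 'x"
    and S :: "'w \<Rightarrow> real"
    and M V \<delta> :: real
    and v :: "nat \<Rightarrow> real"
  assumes prob: "prob_space P"
    and indep: "prob_space.indep_vars P (\<lambda>_. borel) \<epsilon> {1..}"
    and F_meas: "\<And>m. m \<ge> 1 \<Longrightarrow>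
      (\<lambda>(x, y). F m x y) \<in> measurable ((\<Pi>\<^sub>M j\<in>UNIV. borel) \<Otimes>\<^sub>M borel) borel"
    and a_nonneg: "\<And>i. i \<ge> 1 \<Longrightarrow> a i \<ge> 0"
    and a_summable: "summable (\<lambda>j. a (Suc j))"
    and a_sum: "(\<Sum>j. a (Suc j)) < 1"
    and contraction: "\<And>m x x'. m \<ge> 1 \<Longrightarrow>
      (\<integral>\<^sup>+ \<omega>. ennreal (dist (F m x (\<epsilon> m \<omega>)) (F m x' (\<epsilon> m \<omega>))) \<partial>P)
        \<le> (\<Sum>j. ennreal (a (Suc j) * dist (x j) (x' j)))"
    and n: "n \<ge> 1"
    and f_lip: "\<And>x x'. x \<in> {1..n} \<rightarrow>\<^sub>E UNIV \<Longrightarrow> x' \<in> {1..n} \<rightarrow>\<^sub>E UNIV \<Longrightarrow>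
      \<bar>f x - f x'\<bar> \<le> (\<Sum>i = 1..n. dist (x i) (x' i))"
    and X_def: "X = (\<lambda>m \<omega>. chain F x0 (\<lambda>k. \<epsilon> k \<omega>) (int m))"
    and S_def: "S = (\<lambda>\<omega>. f (\<lambda>i\<in>{1..n}. X i \<omega>)
      - prob_space.expectation P (\<lambda>\<omega>'. f (\<lambda>i\<in>{1..n}. X i \<omega>')))"
    and F_lip: "\<And>m x y y'. m \<ge> 1 \<Longrightarrow> dist (F m x y) (F m x y') \<le> dist y y'"
    and M_pos: "M > 0"
    and v_nonneg: "\<And>k. k \<in> {1..n} \<Longrightarrow> v k \<ge> 0"
    and moments: "\<And>k l. k \<in> {1..n} \<Longrightarrow> l \<ge> 2 \<Longrightarrow>
      (\<integral>\<^sup>+ \<omega>. (mean_dist (distr P borel (\<epsilon> k)) (\<epsilon> k \<omega>)) ^ l \<partial>P)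
        \<le> ennreal (fact l / 2 * v k * M ^ (l - 2))"
    and V_def: "V = (\<Sum>k = 1..n. (acoef a (n - k))\<^sup>2 * v k)"
    and \<delta>_def: "\<delta> = M * acoef a (n - 1)"
  shows "\<forall>s\<in>{1, -1}.
    (\<forall>t\<in>{0..<inverse \<delta>}.
      (\<integral>\<^sup>+ \<omega>. ennreal (exp (s * t * S \<omega>)) \<partial>P)
        \<le> ennreal (exp (t\<^sup>2 * V / (2 * (1 - t * \<delta>))))) \<and>
    (\<forall>x>0.
      measure P {\<omega> \<in> space P. s * S \<omega> \<ge> x}
        \<le> exp (- x\<^sup>2 / (V * (1 + sqrt (1 + 2 * x * \<delta> / V)) + x * \<delta>)) \<and>
      exp (- x\<^sup>2 / (V * (1 + sqrt (1 + 2 * x * \<delta> / V)) + x * \<delta>))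
        \<le> exp (- x\<^sup>2 / (2 * (V + x * \<delta>))))"
proof (rule ballI)
  fix s :: real assume "s \<in> {1, -1}"
  then have abs_s: "\<bar>s\<bar> = 1" by auto
  interpret contractive_chain P \<epsilon> F x0 a
    by (intro contractive_chain.intro prob contractive_chain_axioms.intro indep F_meas a_nonneg
        contraction F_lip)
  \<comment> \<open>Pasts list the newest value first, so time \<open>i\<close> sits at entry
    \<open>n - i\<close>. The factor \<open>s\<close> treats both signs at once, as \<open>f\<close>
    and \<open>-f\<close> satisfy the same Lipschitz bound.\<close>
  define g where "g z = s * f (\<lambda>i\<in>{1..n}. z (n - i))" for z :: "nat \<Rightarrow> 'x"
  have reindex: "(\<Sum>i = 1..n. dist (z (n - i)) (z' (n - i))) = (\<Sum>j<n. dist (z j) (z' j))"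
    for z z' :: "nat \<Rightarrow> 'x"
    by (rule sum.reindex_bij_witness[of _ "\<lambda>j. n - j" "\<lambda>i. n - i"]) auto
  have g_lip: "\<bar>g z - g z'\<bar> \<le> (\<Sum>j<n. dist (z j) (z' j))" for z z'
  proof -
    have "\<bar>g z - g z'\<bar> = \<bar>f (\<lambda>i\<in>{1..n}. z (n - i)) - f (\<lambda>i\<in>{1..n}. z' (n - i))\<bar>"
      unfolding g_def right_diff_distrib[symmetric] by (simp add: abs_mult abs_s)
    also have "\<dots> \<le> (\<Sum>i = 1..n. dist (z (n - i)) (z' (n - i)))"
      by (rule order.trans[OF f_lip]) auto
    finally show ?thesis unfolding reindex .
  qed
  have g_meas: "g \<in> borel_measurable states"
    \<comment> \<open>For countably many copies of a Polish space the product sigma-algebra is the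
      Borel one.\<close>
    using borel_measurable_continuous_onI[OF continuous_on_coordinate_lipschitz[OF g_lip]]
    by (simp cong: measurable_cong_sets add: sets_PiM_equal_borel)
  \<comment> \<open>Unit weights on all lags, the case \<open>r = 0\<close>, dominate the sum over
    the first \<open>n\<close> lags.\<close>
  have g_weighted: "weighted_lipschitz (weight a 0) g"
    unfolding weighted_lipschitz_def
  proof (intro allI)
    fix z z'
    have "ennreal \<bar>g z - g z'\<bar> \<le> (\<Sum>j<n. ennreal (dist (z j) (z' j)))"
      using g_lip[of z z'] by (simp add: sum_ennreal ennreal_leI)
    also have "\<dots> \<le> (\<Sum>j. ennreal (dist (z j) (z' j)))"
      by (rule sum_le_suminf) auto
    finally show "ennreal \<bar>g z - g z'\<bar> \<le> (\<Sum>j. ennreal (weight a 0 j * dist (z j) (z' j)))"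
      by simp
  qed
  have g_state: "g (state n \<omega>) = s * f (\<lambda>i\<in>{1..n}. X i \<omega>)" for \<omega>
  proof -
    have "(\<lambda>i\<in>{1..n}. state n \<omega> (n - i)) = (\<lambda>i\<in>{1..n}. X i \<omega>)"
      by (rule restrict_ext) (simp add: X_def past_def of_nat_diff)
    then show ?thesis by (simp add: g_def)
  qed
  have g_centered: "g (state n \<omega>) - (\<integral>\<omega>. g (state n \<omega>) \<partial>P) = s * S \<omega>" for \<omega>
    by (simp add: g_state S_def right_diff_distrib)
  have noise_moments: "(\<integral>\<^sup>+y. mean_dist (noise k) y ^ l \<partial>noise k)
      \<le> ennreal (fact l / 2 * v k * M ^ (l - 2))" if k: "k \<in> {1..n}" and l: "l \<ge> 2" for k l
  proof -
    obtain k' where k': "k = Suc k'" using k by (cases k) auto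
    note [measurable] = borel_measurable_mean_dist[OF prob_space_noise sets_distr, of k']
    show ?thesis
      using moments[OF k l] unfolding k' by (subst nn_integral_distr) measurable
  qed
  \<comment> \<open>The summand \<open>0\<close> matches the induction lemma at
    \<open>r = 0\<close>; the bound is monotonicity with \<open>n - k \<le> n - 1\<close>.\<close>
  have weight_le: "weight a (0 + (n - k)) 0 * M \<le> \<delta>" if "k \<in> {1..n}" for k
    unfolding \<delta>_def weight_zero_eq_acoef[symmetric] mult.commute[of M] using that M_pos
    by (intro mult_right_mono weight_mono a_nonneg) auto
  have \<delta>: "\<delta> > 0"
    unfolding \<delta>_def weight_zero_eq_acoef[symmetric]
    using M_pos weight_ge_1[of a "n - 1" 0] a_nonneg by fastforce
  have V: "V \<ge> 0"
    unfolding V_def using v_nonneg by (intro sum_nonneg mult_nonneg_nonneg) auto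
  have mgf: "(\<integral>\<^sup>+\<omega>. ennreal (exp (t * (s * S \<omega>))) \<partial>P)
      \<le> ennreal (exp (t\<^sup>2 * V / (2 * (1 - t * \<delta>))))" if t: "t \<in> {0..<inverse \<delta>}" for t
  proof -
    have "t * \<delta> < 1" using t \<delta> by (simp add: field_simps)
    with state_integrable_and_mgf[OF g_meas g_weighted v_nonneg _ noise_moments weight_le, of t]
      t M_pos
    show ?thesis
      unfolding g_centered by (simp add: V_def weight_zero_eq_acoef)
  qed
  have "(\<lambda>\<omega>. s * S \<omega>) \<in> borel_measurable P"
    unfolding g_centered[symmetric]
    by (intro borel_measurable_diff measurable_compose[OF measurable_state g_meas]) simp
  note tail = bernstein_tail[OF this V \<delta> _ mgf]
  show "(\<forall>t\<in>{0..<inverse \<delta>}.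
      (\<integral>\<^sup>+ \<omega>. ennreal (exp (s * t * S \<omega>)) \<partial>P)
        \<le> ennreal (exp (t\<^sup>2 * V / (2 * (1 - t * \<delta>))))) \<and>
    (\<forall>x>0.
      measure P {\<omega> \<in> space P. s * S \<omega> \<ge> x}
        \<le> exp (- x\<^sup>2 / (V * (1 + sqrt (1 + 2 * x * \<delta> / V)) + x * \<delta>)) \<and>
      exp (- x\<^sup>2 / (V * (1 + sqrt (1 + 2 * x * \<delta> / V)) + x * \<delta>))
        \<le> exp (- x\<^sup>2 / (2 * (V + x * \<delta>))))"
  proof (intro conjI ballI allI impI)
    show "(\<integral>\<^sup>+ \<omega>. ennreal (exp (s * t * S \<omega>)) \<partial>P)
        \<le> ennreal (exp (t\<^sup>2 * V / (2 * (1 - t * \<delta>))))" if "t \<in> {0..<inverse \<delta>}" for t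
      using mgf[OF that] by (simp add: mult_ac)
  qed (use tail exp_exponent_le[OF V \<delta>] in auto)
qed

end
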